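(* Let $n\in\mathbb{N}$ and $q_1,\ldots,q_n\in(0,1)$, and for $c\in\mathbb{N}$ and $1\le j\le n$ let $Y_j^{(c)}\sim\mathrm{NegBin}(c,q_j)$. Then for every $c\in\mathbb{N}$ and every $j$, the random variables $\frac1cY_j^{(c)}$ and $\frac1{c+1}Y_j^{(c+1)}$ are not stochastically ordered: neither $\frac1cY_j^{(c)}\le_{\rm st}\frac1{c+1}Y_j^{(c+1)}$ nor $\frac1{c+1}Y_j^{(c+1)}\le_{\rm st}\frac1cY_j^{(c)}$ holds.
   Context: $Z_1\le_{\rm st}Z_2$ means $\mathbb{P}(Z_1>z)\le\mathbb{P}(Z_2>z)$ for all real $z$. $\mathrm{NegBin}(c,q)$ is the law of the sum of $c$ independent geometric random variables on $\{1,2,\ldots\}$ with success probability $q$. *)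

theory Defs
  imports "HOL-Probability.Probability"
begin

text \<open>
  \<^const>\<open>geometric_pmf\<close> counts the failures before the first success, so it lives on
  \<open>{0, 1, 2, \<dots>}\<close>; the shift by one gives the number of trials, on \<open>{1, 2, \<dots>}\<close>.
\<close>

definition trials_pmf :: "real \<Rightarrow> nat pmf" where
  "trials_pmf q = map_pmf Suc (geometric_pmf q)"

definition NegBin :: "nat \<Rightarrow> real \<Rightarrow> nat pmf" where
  "NegBin c q = map_pmf (\<lambda>g. \<Sum>i<c. g i) (Pi_pmf {..<c} 0 (\<lambda>_. trials_pmf q))"

text \<open>
  The library's \<^const>\<open>neg_binomial_pmf\<close> counts failures only, hence the shift by \<open>c\<close>.
\<close>

lemma NegBin_eq_neg_binomial_pmf:
  "NegBin c q = map_pmf (\<lambda>k. k + c) (neg_binomial_pmf c q)"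
proof (induction c)
  case 0
  show ?case by (simp add: NegBin_def)
next
  case (Suc c)
  have "NegBin (Suc c) q =
      map_pmf (\<lambda>(x, g). x + (\<Sum>i<c. g i)) (pair_pmf (trials_pmf q) (Pi_pmf {..<c} 0 (\<lambda>_. trials_pmf q)))"
    unfolding NegBin_def lessThan_Suc
    by (subst Pi_pmf_insert) (auto simp: pmf.map_comp o_def case_prod_unfold intro!: map_pmf_cong sum.cong)
  also have "\<dots> = map_pmf (\<lambda>(x, y). x + y) (pair_pmf (trials_pmf q) (NegBin c q))"
    unfolding NegBin_def pair_map_pmf2 by (simp add: pmf.map_comp o_def case_prod_unfold)
  also have "\<dots> = map_pmf (\<lambda>k. k + Suc c) (neg_binomial_pmf (Suc c) q)"
    unfolding Suc.IH trials_pmf_def pair_map_pmf1 pair_map_pmf2 neg_binomial_pmf_Suc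
    by (simp add: pmf.map_comp o_def case_prod_unfold add_ac)
  finally show ?case .
qed

text \<open>
  The stochastic order depends on the two laws only, so the two variables may live on different
  probability spaces.
\<close>

definition st_le :: "'a measure \<Rightarrow> ('a \<Rightarrow> real) \<Rightarrow> 'b measure \<Rightarrow> ('b \<Rightarrow> real) \<Rightarrow> bool" where
  "st_le M X N Y \<longleftrightarrow>
     (\<forall>z. measure M {\<omega> \<in> space M. X \<omega> > z} \<le> measure N {\<omega> \<in> space N. Y \<omega> > z})"

definition has_law :: "'a measure \<Rightarrow> ('a \<Rightarrow> real) \<Rightarrow> nat pmf \<Rightarrow> bool" where
  "has_law M X p \<longleftrightarrow>
     X \<in> borel_measurable M \<and> distr M borel X = distr (measure_pmf p) borel real"

end

theory Submission
  imports Defs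
begin

text \<open>
  At \<open>z = 1\<close> the two tails are \<open>1 - q ^ c\<close> and \<open>1 - q ^ (c + 1)\<close>, which excludes one direction. For
  large \<open>z\<close> the tail of \<open>Y / c\<close> is of order \<open>(1 - q) ^ (c z)\<close> up to a polynomial factor, so the
  average over \<open>c\<close> summands has the heavier tail, which excludes the other. The polynomial factor
  is avoided by exponential tilting: for every \<open>s \<in> {1 - q<..<1}\<close>, the negative binomial law with
  success probability \<open>q\<close> has density \<open>(q / (1 - s)) ^ n * ((1 - q) / s) ^ k\<close> with respect to the
  one with success probability \<open>1 - s\<close>.
\<close>

text \<open>Summing the pointwise bound over \<open>S\<close> leaves \<open>B\<close> times the mass
  that \<open>r\<close> puts on \<open>S\<close>, and that mass is at most 1.\<close>

lemma prob_pmf_le_of_pmf_le: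
  assumes "\<And>x. x \<in> S \<Longrightarrow> pmf p x \<le> B * pmf r x" and "B \<ge> 0"
  shows "measure_pmf.prob p S \<le> B"
proof -
  have "emeasure p S = (\<integral>\<^sup>+x. pmf p x \<partial>count_space S)"
    by (rule nn_integral_pmf[symmetric])
  also have "\<dots> \<le> (\<integral>\<^sup>+x. ennreal B * pmf r x \<partial>count_space S)"
    using assms by (intro nn_integral_mono) (auto simp flip: ennreal_mult)
  also have "\<dots> = ennreal B * emeasure r S"
    by (subst nn_integral_cmult) (simp_all add: nn_integral_pmf)
  also have "\<dots> \<le> ennreal B * 1"
    by (intro mult_left_mono measure_pmf.emeasure_le_1) auto
  finally show ?thesis
    using assms(2) by (simp add: measure_pmf.emeasure_eq_measure)
qed

text \<open>Since \<open>1 - q \<le> s\<close>, the tilting density is nonincreasing in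
  \<open>k\<close>, so beyond \<open>N\<close> it is bounded by its value at \<open>N\<close>. The
  parameter \<open>s\<close> stays free, to be adapted to \<open>n\<close> later.\<close>

lemma neg_binomial_tail_le:
  assumes q: "q \<in> {0<..<1}" and s: "1 - q \<le> s" "s < 1"
  shows "measure_pmf.prob (neg_binomial_pmf n q) {N<..} \<le> (q / (1 - s)) ^ n * ((1 - q) / s) ^ N"
proof (rule prob_pmf_le_of_pmf_le[where r = "neg_binomial_pmf n (1 - s)"])
  fix k assume "k \<in> {N<..}"
  have s0: "s > 0" using q s by auto
  have "((1 - q) / s) ^ k \<le> ((1 - q) / s) ^ N"
    using q s s0 \<open>k \<in> {N<..}\<close> by (intro power_decreasing) auto
  have "pmf (neg_binomial_pmf n q) k
      = (q / (1 - s)) ^ n * ((1 - q) / s) ^ k * pmf (neg_binomial_pmf n (1 - s)) k"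
    using q s s0 by (simp add: pmf_neg_binomial power_divide)
  also have "\<dots> \<le> (q / (1 - s)) ^ n * ((1 - q) / s) ^ N * pmf (neg_binomial_pmf n (1 - s)) k"
    using \<open>((1 - q) / s) ^ k \<le> _\<close> q s by (intro mult_right_mono mult_left_mono) auto
  finally show "pmf (neg_binomial_pmf n q) k
      \<le> (q / (1 - s)) ^ n * ((1 - q) / s) ^ N * pmf (neg_binomial_pmf n (1 - s)) k" .
qed (use q s in auto)

text \<open>The first atom of the tail, \<open>Suc N\<close>, already has this much mass: its
  binomial coefficient is at least 1 because \<open>n \<ge> 1\<close> gives
  \<open>Suc N \<le> Suc N + n - 1\<close>.\<close>

lemma neg_binomial_tail_ge:
  assumes q: "q \<in> {0<..<1}" and n: "n \<ge> 1"
  shows "q ^ n * (1 - q) ^ Suc N \<le> measure_pmf.prob (neg_binomial_pmf n q) {N<..}"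
proof -
  have "1 \<le> real ((Suc N + n - 1) choose Suc N)"
    using n by (simp add: Suc_le_eq zero_less_binomial_iff del: binomial_Suc_Suc)
  hence "1 * (q ^ n * (1 - q) ^ Suc N)
      \<le> real ((Suc N + n - 1) choose Suc N) * (q ^ n * (1 - q) ^ Suc N)"
    using q by (intro mult_right_mono) auto
  also have "\<dots> = pmf (neg_binomial_pmf n q) (Suc N)"
    using q by (simp add: pmf_neg_binomial mult.assoc)
  also have "\<dots> = measure_pmf.prob (neg_binomial_pmf n q) {Suc N}"
    by (simp add: measure_pmf_single)
  also have "\<dots> \<le> measure_pmf.prob (neg_binomial_pmf n q) {N<..}"
    by (intro measure_pmf.finite_measure_mono) auto
  finally show ?thesis by simp
qed

lemma neg_binomial_tail_0:
  assumes q: "q \<in> {0<..<1}"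
  shows "measure_pmf.prob (neg_binomial_pmf n q) {0<..} = 1 - q ^ n"
proof -
  have "{0<..} = UNIV - {0 :: nat}" by auto
  thus ?thesis
    using q measure_pmf.prob_compl[of "{0}" "neg_binomial_pmf n q"]
    by (simp add: measure_pmf_single pmf_neg_binomial)
qed

text \<open>The upper bound for \<open>c + 1\<close> and the lower bound for \<open>c\<close> share
  the factor \<open>(1 - q) ^ (c * m)\<close>. What remains is \<open>C * s ^ m\<close> against a
  positive constant, so any large \<open>m\<close> works.\<close>

lemma neg_binomial_tails_cross:
  assumes q: "q \<in> {0<..<1}" and c: "c \<ge> 1"
  obtains m where "measure_pmf.prob (neg_binomial_pmf (c + 1) q) {(c + 1) * m<..}
                     < measure_pmf.prob (neg_binomial_pmf c q) {c * m<..}"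
proof -
  define s where "s = root (c + 2) (1 - q)"
  \<comment> \<open>With this exponent \<open>((1 - q) / s) ^ (c + 1) = s * (1 - q) ^ c\<close>.\<close>
  have sp: "s ^ (c + 2) = 1 - q" and s: "0 < s" "s < 1"
    using q by (auto simp: s_def simp del: power_Suc)
  have "s ^ (c + 2) \<le> s ^ 1"
    using s by (intro power_decreasing) auto
  hence s': "1 - q \<le> s" using sp by simp
  define C where "C = (q / (1 - s)) ^ (c + 1)"
  have "(\<lambda>m. C * s ^ m) \<longlonglongrightarrow> C * 0"
    using s by (intro tendsto_mult tendsto_const LIMSEQ_realpow_zero) auto
  moreover have "C * 0 < q ^ c * (1 - q)" using q by auto
  ultimately have "\<forall>\<^sub>F m in sequentially. C * s ^ m < q ^ c * (1 - q)"
    by (rule order_tendstoD)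
  then obtain m where m: "C * s ^ m < q ^ c * (1 - q)"
    by (auto simp: eventually_sequentially)
  have "(1 - q) / s = s ^ (c + 1)"
    using s by (simp flip: sp)
  hence "((1 - q) / s) ^ ((c + 1) * m) = s ^ ((c + 1) * ((c + 1) * m))"
    by (simp only: power_mult)
  \<comment> \<open>As \<open>(c + 1)^2 = 1 + c * (c + 2)\<close>, exactly one spare factor
    \<open>s\<close> per unit of \<open>m\<close> is left after the powers of
    \<open>s ^ (c + 2) = 1 - q\<close> are collected.\<close>
  also have "(c + 1) * ((c + 1) * m) = m + (c + 2) * (c * m)"
    by (simp add: algebra_simps)
  also have "s ^ \<dots> = s ^ m * (1 - q) ^ (c * m)"
    by (simp only: power_add[of s m] power_mult[of s "c + 2"] sp)
  finally have eq: "((1 - q) / s) ^ ((c + 1) * m) = s ^ m * (1 - q) ^ (c * m)" .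
  have "measure_pmf.prob (neg_binomial_pmf (c + 1) q) {(c + 1) * m<..}
      \<le> C * ((1 - q) / s) ^ ((c + 1) * m)"
    unfolding C_def using q s' s(2) by (rule neg_binomial_tail_le)
  also have "\<dots> = C * s ^ m * (1 - q) ^ (c * m)"
    by (simp only: eq mult.assoc)
  also have "\<dots> < q ^ c * (1 - q) * (1 - q) ^ (c * m)"
    using m q by (intro mult_strict_right_mono) auto
  also have "\<dots> \<le> measure_pmf.prob (neg_binomial_pmf c q) {c * m<..}"
    using neg_binomial_tail_ge[OF q c, of "c * m"] by (simp add: mult.assoc)
  finally show ?thesis by (rule that)
qed

text \<open>Trials are failures plus \<open>c\<close>, so more than \<open>c * (m + 1)\<close>
  trials means more than \<open>c * m\<close> failures. Thresholds of the form \<open>m + 1\<close>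
  keep this cutoff an integer for \<open>c\<close> and \<open>c + 1\<close> alike.\<close>

lemma prob_has_law_NegBin_gt:
  assumes "has_law M X (NegBin c q)" and c: "c \<ge> 1"
  shows "measure M {\<omega> \<in> space M. 1 / real c * X \<omega> > real (m + 1)}
           = measure_pmf.prob (neg_binomial_pmf c q) {c * m<..}"
proof -
  let ?A = "{real c * real (m + 1)<..}"
  have X: "X \<in> borel_measurable M"
    and D: "distr M borel X = distr (measure_pmf (NegBin c q)) borel real"
    using assms(1) by (auto simp: has_law_def)
  have "{\<omega> \<in> space M. 1 / real c * X \<omega> > real (m + 1)} = X -` ?A \<inter> space M"
    using c by (auto simp: field_simps)
  hence "measure M {\<omega> \<in> space M. 1 / real c * X \<omega> > real (m + 1)} = measure (distr M borel X) ?A"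
    using X by (simp add: measure_distr)
  also have "\<dots> = measure_pmf.prob (NegBin c q) (real -` ?A)"
    unfolding D by (simp add: measure_distr)
  also have "real -` ?A = {c * (m + 1)<..}"
    by (auto simp flip: of_nat_mult simp del: of_nat_Suc of_nat_add)
  also have "measure_pmf.prob (NegBin c q) \<dots>
      = measure_pmf.prob (neg_binomial_pmf c q) ((\<lambda>k. k + c) -` {c * (m + 1)<..})"
    unfolding NegBin_eq_neg_binomial_pmf by simp
  also have "(\<lambda>k. k + c) -` {c * (m + 1)<..} = {c * m<..}"
    by (auto simp: algebra_simps)
  finally show ?thesis .
qed

theorem proposition18:
  fixes n :: nat and q :: "nat \<Rightarrow> real"
    and M :: "nat \<Rightarrow> nat \<Rightarrow> 'a measure" and Y :: "nat \<Rightarrow> nat \<Rightarrow> 'a \<Rightarrow> real"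
  assumes "n \<ge> 1"
    and "\<And>j. j \<in> {1..n} \<Longrightarrow> q j \<in> {0<..<1}"
    and "\<And>j c. j \<in> {1..n} \<Longrightarrow> c \<ge> 1 \<Longrightarrow> prob_space (M j c)"
    and "\<And>j c. j \<in> {1..n} \<Longrightarrow> c \<ge> 1 \<Longrightarrow> has_law (M j c) (Y j c) (NegBin c (q j))"
  shows "\<forall>c\<ge>1. \<forall>j\<in>{1..n}.
     \<not> st_le (M j c) (\<lambda>\<omega>. 1 / real c * Y j c \<omega>)
             (M j (c + 1)) (\<lambda>\<omega>. 1 / real (c + 1) * Y j (c + 1) \<omega>) \<and>
     \<not> st_le (M j (c + 1)) (\<lambda>\<omega>. 1 / real (c + 1) * Y j (c + 1) \<omega>)
             (M j c) (\<lambda>\<omega>. 1 / real c * Y j c \<omega>)"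
proof (intro allI impI ballI)
  fix c j :: nat assume c: "1 \<le> c" and j: "j \<in> {1..n}"
  note q = assms(2)[OF j]
  have c': "1 \<le> c + 1" by simp
  note tail = prob_has_law_NegBin_gt[OF assms(4)[OF j c] c]
    and tail' = prob_has_law_NegBin_gt[OF assms(4)[OF j c'] c']
  obtain m where "measure_pmf.prob (neg_binomial_pmf (c + 1) (q j)) {(c + 1) * m<..}
                    < measure_pmf.prob (neg_binomial_pmf c (q j)) {c * m<..}"
    using neg_binomial_tails_cross[OF q c] .
  \<comment> \<open>Both tails belong to the same threshold \<open>z = real (m + 1)\<close>, which
    refutes the order.\<close>
  hence "\<not> st_le (M j c) (\<lambda>\<omega>. 1 / real c * Y j c \<omega>)
             (M j (c + 1)) (\<lambda>\<omega>. 1 / real (c + 1) * Y j (c + 1) \<omega>)"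
    unfolding st_le_def not_all not_le tail[of m, symmetric] tail'[of m, symmetric] by (rule exI)
  \<comment> \<open>Here \<open>m = 0\<close>, that is \<open>z = 1\<close>: the tail is the
    probability of at least one failure, and \<open>q j ^ (c + 1) < q j ^ c\<close>.\<close>
  moreover have "measure_pmf.prob (neg_binomial_pmf c (q j)) {c * 0<..}
                    < measure_pmf.prob (neg_binomial_pmf (c + 1) (q j)) {(c + 1) * 0<..}"
    using q by (simp add: neg_binomial_tail_0)
  hence "\<not> st_le (M j (c + 1)) (\<lambda>\<omega>. 1 / real (c + 1) * Y j (c + 1) \<omega>)
             (M j c) (\<lambda>\<omega>. 1 / real c * Y j c \<omega>)"
    unfolding st_le_def not_all not_le tail[of 0, symmetric] tail'[of 0, symmetric] by (rule exI)
  ultimately show "\<not> st_le (M j c) (\<lambda>\<omega>. 1 / real c * Y j c \<omega>)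
             (M j (c + 1)) (\<lambda>\<omega>. 1 / real (c + 1) * Y j (c + 1) \<omega>) \<and>
     \<not> st_le (M j (c + 1)) (\<lambda>\<omega>. 1 / real (c + 1) * Y j (c + 1) \<omega>)
             (M j c) (\<lambda>\<omega>. 1 / real c * Y j c \<omega>)" ..
qed

end
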